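(* (Picard's theorem.) Let $\Omega\subset\mathbb{C}$ be a domain, let $\nu:\Omega\to\mathbb{R}$ be a real-valued function, and let $Q_k$, $k=1,2,3,4$, be four solutions in $\Omega$ of the complex differential Riccati equation $$\partial_{\overline z}Q+|Q|^2=\frac{\nu}{4}.$$ Then, at every point of $\Omega$ where the denominators below are nonzero, $$\frac{\partial_{\overline z}(Q_1-Q_2)+2i\operatorname{Im}(\overline{Q}_1Q_2)}{Q_1-Q_2}+\frac{\partial_{\overline z}(Q_3-Q_4)+2i\operatorname{Im}(\overline{Q}_3Q_4)}{Q_3-Q_4}$$ $$-\frac{\partial_{\overline z}(Q_1-Q_4)+2i\operatorname{Im}(\overline{Q}_1Q_4)}{Q_1-Q_4}-\frac{\partial_{\overline z}(Q_3-Q_2)+2i\operatorname{Im}(\overline{Q}_3Q_2)}{Q_3-Q_2}=0.$$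
   Context: Here $z=x+iy$, $\partial_{\overline z}=\frac12(\partial_x+i\partial_y)$. Functions $Q_k$ are complex-valued, not assumed analytic; solutions are understood in the classical sense (continuously differentiable). Standing assumption of the paper at this point: the Riccati equation possesses a bounded solution in $\Omega$. *)

theory Defs
  imports "HOL-Analysis.Analysis"
begin

text \<open>
  Derivatives are taken over the reals, with the complex plane regarded as the
  \<open>(x, y)\<close>-plane; no analyticity is implied.
\<close>

definition partial_x :: "(complex \<Rightarrow> complex) \<Rightarrow> complex \<Rightarrow> complex" where
  "partial_x f z = vector_derivative (\<lambda>t::real. f (z + of_real t)) (at 0)"

definition partial_y :: "(complex \<Rightarrow> complex) \<Rightarrow> complex \<Rightarrow> complex" where
  "partial_y f z = vector_derivative (\<lambda>t::real. f (z + \<i> * of_real t)) (at 0)"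

definition dbar :: "(complex \<Rightarrow> complex) \<Rightarrow> complex \<Rightarrow> complex" where
  "dbar f z = (partial_x f z + \<i> * partial_y f z) / 2"

definition continuously_differentiable_on ::
    "(complex \<Rightarrow> complex) \<Rightarrow> complex set \<Rightarrow> bool" where
  "continuously_differentiable_on f \<Omega> \<longleftrightarrow>
     (\<exists>f' :: complex \<Rightarrow> complex \<Rightarrow>\<^sub>L complex.
        (\<forall>z\<in>\<Omega>. (f has_derivative blinfun_apply (f' z)) (at z)) \<and> continuous_on \<Omega> f')"

definition riccati_solution ::
    "complex set \<Rightarrow> (complex \<Rightarrow> real) \<Rightarrow> (complex \<Rightarrow> complex) \<Rightarrow> bool" where
  "riccati_solution \<Omega> \<nu> Q \<longleftrightarrow>
     continuously_differentiable_on Q \<Omega> \<and>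
     (\<forall>z\<in>\<Omega>. dbar Q z + complex_of_real ((cmod (Q z))\<^sup>2) = complex_of_real (\<nu> z / 4))"

end

theory Submission
  imports Defs
begin

text \<open>
  Subtracting the Riccati equations of two solutions \<open>P\<close>, \<open>Q\<close> removes \<open>\<nu>\<close> and leaves
  \<open>|Q|\<^sup>2 - |P|\<^sup>2\<close> for the derivative of \<open>P - Q\<close>. Adding
  \<open>2 i Im (cnj P * Q) = cnj P * Q - P * cnj Q\<close> makes the numerator factor as
  \<open>- (P - Q) * cnj (P + Q)\<close>, so each quotient equals \<open>- cnj (P + Q)\<close> and the four cancel.
\<close>

text \<open>Chain rule along the line through \<open>z\<close> with direction \<open>c\<close>; the
  directions 1 and \<i> will give \<open>partial_x\<close> and \<open>partial_y\<close>.\<close>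

lemma has_vector_derivative_along_line:
  fixes f :: "complex \<Rightarrow> complex"
  assumes "(f has_derivative f') (at z)"
  shows "((\<lambda>t::real. f (z + c * of_real t)) has_vector_derivative f' c) (at 0)"
proof -
  have "((\<lambda>t::real. z + c * of_real t) has_vector_derivative c) (at 0)"
    by (auto intro!: derivative_eq_intros)
  \<comment> \<open>The chain rule used below asks for the derivative of \<open>f\<close> only
    within the image of the line, at the point with parameter 0.\<close>
  moreover have "(f has_derivative f') (at (z + c * of_real 0) within range (\<lambda>t::real. z + c * of_real t))"
    using assms by (simp add: has_derivative_at_withinI)
  ultimately show ?thesis
    using vector_derivative_diff_chain_within[of "\<lambda>t. z + c * of_real t" c 0 UNIV f f']
    by (simp add: o_def)
qed

lemma dbar_eq_has_derivative:
  assumes "(f has_derivative f') (at z)"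
  shows "dbar f z = (f' 1 + \<i> * f' \<i>) / 2"
  using has_vector_derivative_along_line[OF assms, of 1]
    has_vector_derivative_along_line[OF assms, of \<i>]
  by (simp add: dbar_def partial_x_def partial_y_def vector_derivative_at)

text \<open>\<open>vector_derivative\<close> is a choice operator, so additivity is only safe where
  derivatives exist; total derivatives supply both partials at once.\<close>

lemma dbar_diff:
  assumes "f differentiable (at z)" and "g differentiable (at z)"
  shows "dbar (\<lambda>w. f w - g w) z = dbar f z - dbar g z"
proof -
  from assms obtain f' g' where fg: "(f has_derivative f') (at z)" "(g has_derivative g') (at z)"
    by (auto simp: differentiable_def)
  show ?thesis
    unfolding dbar_eq_has_derivative[OF fg(1)] dbar_eq_has_derivative[OF fg(2)]
      dbar_eq_has_derivative[OF has_derivative_diff[OF fg]]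
    by (simp add: field_simps)
qed

lemma riccati_solution_differentiable:
  assumes "riccati_solution \<Omega> \<nu> Q" and "z \<in> \<Omega>"
  shows "Q differentiable (at z)"
  using assms
  by (auto simp: riccati_solution_def continuously_differentiable_on_def differentiable_def)

text \<open>Writing the squared modulus as a product with the conjugate turns the later
  factorization into polynomial algebra.\<close>

lemma riccati_solution_dbar:
  assumes "riccati_solution \<Omega> \<nu> Q" and "z \<in> \<Omega>"
  shows "dbar Q z = of_real (\<nu> z / 4) - Q z * cnj (Q z)"
  using assms unfolding riccati_solution_def complex_norm_square eq_diff_eq by blast

lemma two_i_Im_cnj_mult:
  "2 * \<i> * of_real (Im (cnj a * b)) = cnj a * b - a * cnj b"
  by (simp add: complex_eq_iff)

lemma riccati_solution_diff_quotient:
  assumes "riccati_solution \<Omega> \<nu> P" and "riccati_solution \<Omega> \<nu> Q"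
    and "z \<in> \<Omega>" and "P z - Q z \<noteq> 0"
  shows "(dbar (\<lambda>w. P w - Q w) z + 2 * \<i> * of_real (Im (cnj (P z) * Q z))) / (P z - Q z)
    = - cnj (P z + Q z)"
proof -
  have "dbar (\<lambda>w. P w - Q w) z = Q z * cnj (Q z) - P z * cnj (P z)"
    using assms
    by (simp add: dbar_diff riccati_solution_differentiable riccati_solution_dbar)
  then have "dbar (\<lambda>w. P w - Q w) z + 2 * \<i> * of_real (Im (cnj (P z) * Q z))
    = - cnj (P z + Q z) * (P z - Q z)"
    unfolding two_i_Im_cnj_mult by (simp add: algebra_simps)
  with assms(4) show ?thesis
    by simp
qed

theorem theorem11:
  fixes \<Omega> :: "complex set"
    and \<nu> :: "complex \<Rightarrow> real"
    and Q\<^sub>1 Q\<^sub>2 Q\<^sub>3 Q\<^sub>4 :: "complex \<Rightarrow> complex"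
    and z :: complex
  assumes "open \<Omega>" and "connected \<Omega>" and "\<Omega> \<noteq> {}"
    and "\<exists>Q. riccati_solution \<Omega> \<nu> Q \<and> bounded (Q ` \<Omega>)"
    and "riccati_solution \<Omega> \<nu> Q\<^sub>1" and "riccati_solution \<Omega> \<nu> Q\<^sub>2"
    and "riccati_solution \<Omega> \<nu> Q\<^sub>3" and "riccati_solution \<Omega> \<nu> Q\<^sub>4"
    and "z \<in> \<Omega>"
    and "Q\<^sub>1 z - Q\<^sub>2 z \<noteq> 0" and "Q\<^sub>3 z - Q\<^sub>4 z \<noteq> 0"
    and "Q\<^sub>1 z - Q\<^sub>4 z \<noteq> 0" and "Q\<^sub>3 z - Q\<^sub>2 z \<noteq> 0"
  shows
    "(dbar (\<lambda>w. Q\<^sub>1 w - Q\<^sub>2 w) z + 2 * \<i> * of_real (Im (cnj (Q\<^sub>1 z) * Q\<^sub>2 z))) / (Q\<^sub>1 z - Q\<^sub>2 z)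
   + (dbar (\<lambda>w. Q\<^sub>3 w - Q\<^sub>4 w) z + 2 * \<i> * of_real (Im (cnj (Q\<^sub>3 z) * Q\<^sub>4 z))) / (Q\<^sub>3 z - Q\<^sub>4 z)
   - (dbar (\<lambda>w. Q\<^sub>1 w - Q\<^sub>4 w) z + 2 * \<i> * of_real (Im (cnj (Q\<^sub>1 z) * Q\<^sub>4 z))) / (Q\<^sub>1 z - Q\<^sub>4 z)
   - (dbar (\<lambda>w. Q\<^sub>3 w - Q\<^sub>2 w) z + 2 * \<i> * of_real (Im (cnj (Q\<^sub>3 z) * Q\<^sub>2 z))) / (Q\<^sub>3 z - Q\<^sub>2 z) = 0"
  \<comment> \<open>The index pairs (1,2), (3,4) enter with one sign and (1,4), (3,2) with the
    other, so each conjugate \<open>cnj (Q\<^sub>k z)\<close> occurs once with each sign.\<close>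
  unfolding riccati_solution_diff_quotient[OF assms(5,6,9,10)]
    riccati_solution_diff_quotient[OF assms(7,8,9,11)]
    riccati_solution_diff_quotient[OF assms(5,8,9,12)]
    riccati_solution_diff_quotient[OF assms(7,6,9,13)]
  by simp

end
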